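(* Let $q\in(0,1)$. For each $f \in C[0,1]$, $$M(r;D_{\infty,q}f)=O\big((-r;q)_{\infty}\big), \quad r \to \infty.$$
   Context: For $a\in\mathbb{C}$ and $0<q<1$, the $q$-Pochhammer symbols are $(a;q)_0=1$, $(a;q)_n=\prod_{j=0}^{n-1}(1-aq^j)$, $(a;q)_\infty=\prod_{j=0}^{\infty}(1-aq^j)$. The limit $q$-Durrmeyer operator is defined for $f\in C[0,1]$ by $(D_{\infty,q}f)(x)=\sum_{k=0}^{\infty} A_{\infty k}(f)\, p_{\infty k}(q;x)$ for $x\in[0,1)$ and $(D_{\infty,q}f)(1)=f(1)$, where $p_{\infty k}(q;x)=\frac{(x;q)_\infty\, x^k}{(q;q)_k}$ and $A_{\infty k}(f)=\frac{q^{-k}}{1-q}\int_0^1 f(t)\,p_{\infty k}(q;qt)\,d_qt$. Here the $q$-integral is $\int_0^a h(t)\,d_qt=(1-q)a\sum_{j=0}^\infty q^j h(aq^j)$. Equivalently, $A_{\infty k}(f)=\frac{(q;q)_\infty}{(q;q)_k}\sum_{j=0}^\infty \frac{f(q^j)q^{(k+1)j}}{(q;q)_j}$. The function $D_{\infty,q}f$ extends (uniquely) from $[0,1]$ to an entire function, still denoted $D_{\infty,q}f$. For a function $h$ analytic in the closed disc $\Delta_r=\{z\in\mathbb{C}:|z|\leqslant r\}$, $M(r;h)=\max_{z\in\Delta_r}|h(z)|$. *)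

theory Defs
  imports
    "HOL-Complex_Analysis.Complex_Analysis"
    "HOL-Library.Landau_Symbols"
begin

definition q_pochhammer :: "'a::real_normed_field \<Rightarrow> real \<Rightarrow> nat \<Rightarrow> 'a" where
  "q_pochhammer a q n = (\<Prod>j<n. 1 - a * of_real q ^ j)"

definition q_pochhammer_inf :: "'a::real_normed_field \<Rightarrow> real \<Rightarrow> 'a" where
  "q_pochhammer_inf a q = prodinf (\<lambda>j. 1 - a * of_real q ^ j)"

lemma q_pochhammer_inf_has_prod:
  fixes a :: "'a::{real_normed_field,banach}"
  assumes "0 < q" "q < 1"
  shows "(\<lambda>j. 1 - a * of_real q ^ j) has_prod q_pochhammer_inf a q"
proof -
  have "summable (\<lambda>j. norm (1 - a * of_real q ^ j - 1))"
    using assms by (simp add: norm_mult norm_power summable_mult summable_geometric)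
  then show ?thesis
    unfolding q_pochhammer_inf_def
    by (intro convergent_prod_has_prod abs_convergent_prod_imp_convergent_prod
        summable_imp_abs_convergent_prod)
qed

text \<open>The \<open>q\<close>-integral of \<open>h\<close> from \<open>0\<close> to \<open>a\<close>.\<close>

definition q_integral :: "real \<Rightarrow> real \<Rightarrow> (real \<Rightarrow> 'a::real_normed_vector) \<Rightarrow> 'a" where
  "q_integral q a h = ((1 - q) * a) *\<^sub>R (\<Sum>j. q ^ j *\<^sub>R h (a * q ^ j))"

text \<open>The functions \<open>p\<^sub>\<infinity>\<^sub>k(q; x)\<close>.\<close>

definition limit_q_basis :: "real \<Rightarrow> nat \<Rightarrow> real \<Rightarrow> real" where
  "limit_q_basis q k x = q_pochhammer_inf x q * x ^ k / q_pochhammer q q k"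

text \<open>The functionals \<open>A\<^sub>\<infinity>\<^sub>k(f)\<close>.\<close>

definition q_durrmeyer_coeff :: "real \<Rightarrow> (real \<Rightarrow> complex) \<Rightarrow> nat \<Rightarrow> complex" where
  "q_durrmeyer_coeff q f k =
     (q powi (- int k) / (1 - q)) *\<^sub>R
       q_integral q 1 (\<lambda>t. f t * of_real (limit_q_basis q k (q * t)))"

text \<open>Only the values on the interval \<open>[0, 1]\<close> are meaningful.\<close>

definition q_durrmeyer :: "real \<Rightarrow> (real \<Rightarrow> complex) \<Rightarrow> real \<Rightarrow> complex" where
  "q_durrmeyer q f x =
     (if x = 1 then f 1
      else (\<Sum>k. q_durrmeyer_coeff q f k * of_real (limit_q_basis q k x)))"

definition is_entire_extension :: "(real \<Rightarrow> complex) \<Rightarrow> (complex \<Rightarrow> complex) \<Rightarrow> bool" where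
  "is_entire_extension g F \<longleftrightarrow>
     F holomorphic_on UNIV \<and> (\<forall>x\<in>{0..1}. F (of_real x) = g x)"

lemma is_entire_extension_unique:
  assumes "is_entire_extension g F" "is_entire_extension g G"
  shows "F = G"
proof
  fix w
  have "(0::real) islimpt {0..1}"
    by (simp add: islimpt_Icc)
  then have lim: "(0::complex) islimpt of_real ` {0..1::real}"
    unfolding islimpt_approachable by (fastforce simp: dist_norm)
  have "F w - G w = 0"
    by (rule analytic_continuation[OF _ _ _ _ _ lim, of "\<lambda>z. F z - G z" UNIV])
      (use assms in \<open>auto simp: is_entire_extension_def intro!: holomorphic_on_diff\<close>)
  then show "F w = G w" by simp
qed

text \<open>
  The entire function extending the limit \<open>q\<close>-Durrmeyer image of \<open>f\<close>; by
  the lemma above it is unique, so the description is definite whenever an extension exists.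
\<close>

definition q_durrmeyer_entire :: "real \<Rightarrow> (real \<Rightarrow> complex) \<Rightarrow> complex \<Rightarrow> complex" where
  "q_durrmeyer_entire q f = (THE F. is_entire_extension (q_durrmeyer q f) F)"

definition max_modulus :: "real \<Rightarrow> (complex \<Rightarrow> complex) \<Rightarrow> real" where
  "max_modulus r h = (SUP z\<in>cball 0 r. norm (h z))"

text \<open>The supremum is a maximum as soon as \<open>h\<close> is continuous on the closed disc.\<close>

lemma max_modulus_attained:
  assumes "0 \<le> r" "continuous_on (cball 0 r) h"
  shows "\<exists>z\<in>cball 0 r. norm (h z) = max_modulus r h \<and> (\<forall>w\<in>cball 0 r. norm (h w) \<le> norm (h z))"
proof -
  have "continuous_on (cball 0 r) (\<lambda>z. norm (h z))"
    using assms(2) by (rule continuous_on_norm)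
  then obtain z where z: "z \<in> cball 0 r" "\<forall>w\<in>cball 0 r. norm (h w) \<le> norm (h z)"
    using continuous_attains_sup[of "cball 0 r" "\<lambda>z. norm (h z)"] assms(1) by auto
  then have "max_modulus r h = norm (h z)"
    unfolding max_modulus_def by (intro cSup_eq_maximum) auto
  with z show ?thesis by auto
qed

end

theory Submission
  imports Defs
begin

text \<open>
  The image of \<open>f\<close> has a Newton-type expansion \<open>\<Sum>n. c n * (z; q)\<^sub>n\<close>, where \<open>c\<close> is the Cauchy product
  of the two absolutely summable sequences \<open>f (q^j) * q^j / (q; q)\<^sub>j\<close> and
  \<open>(-1)^m * q^(m (m + 1) / 2) / (q; q)\<^sub>m\<close>. Indeed, for \<open>0 \<le> x < 1\<close>, Euler's first identity gives
  \<open>(x; q)\<^sub>n = (x; q)\<^sub>\<infinity> * (\<Sum>k. (x * q^n)^k / (q; q)\<^sub>k)\<close>, and exchanging the sums leaves the coefficients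
  \<open>\<Sum>n. c n * (q^k)^n\<close>, a product of two power series in \<open>q^k\<close>; by Euler's second identity it is
  \<open>A\<^sub>\<infinity>\<^sub>k(f)\<close>. Since \<open>\<bar>(z; q)\<^sub>n\<bar> \<le> (-\<bar>z\<bar>; q)\<^sub>\<infinity>\<close>, the expansion converges locally uniformly, hence is
  the entire extension, and it is bounded by \<open>(\<Sum>n. \<bar>c n\<bar>) * (-\<bar>z\<bar>; q)\<^sub>\<infinity>\<close>.
\<close>

section \<open>Interchange of iterated series\<close>

text \<open>The product \<open>u n * v k\<close> is summable over all pairs, so \<open>f\<close> is
  absolutely summable there and Fubini for \<open>infsum\<close> applies. Most of the work is
  translating between \<open>suminf\<close> and \<open>infsum\<close>, which uses absolute
  convergence of the inner series (\<open>sum1\<close>, \<open>sum2\<close>) and of the outer ones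
  (\<open>n1\<close>, \<open>n2\<close>).\<close>

lemma suminf_swap_dominated:
  fixes f :: "nat \<Rightarrow> nat \<Rightarrow> 'a::banach"
  assumes bound: "\<And>n k. norm (f n k) \<le> u n * v k"
    and u: "summable u" "\<And>n. 0 \<le> u n"
    and v: "summable v" "\<And>k. 0 \<le> v k"
  shows "(\<Sum>n. \<Sum>k. f n k) = (\<Sum>k. \<Sum>n. f n k)"
proof -
  have sum1: "summable (\<lambda>k. norm (f n k))" for n
    by (rule summable_comparison_test'[where g="\<lambda>k. u n * v k"])
      (use bound v in \<open>auto intro: summable_mult\<close>)
  have sum2: "summable (\<lambda>n. norm (f n k))" for k
    by (rule summable_comparison_test'[where g="\<lambda>n. u n * v k"])
      (use bound u in \<open>auto intro: summable_mult2\<close>)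
  have inf1: "infsum (f n) UNIV = (\<Sum>k. f n k)" for n
    by (rule infsumI, rule norm_summable_imp_has_sum)
      (use sum1 in \<open>auto intro: summable_norm_cancel\<close>)
  have inf2: "infsum (\<lambda>n. f n k) UNIV = (\<Sum>n. f n k)" for k
    by (rule infsumI, rule norm_summable_imp_has_sum)
      (use sum2 in \<open>auto intro: summable_norm_cancel\<close>)
  have b1: "norm (\<Sum>k. f n k) \<le> u n * suminf v" for n
    by (subst suminf_mult[OF v(1), symmetric], rule norm_suminf_le)
      (use bound v in \<open>auto intro: summable_mult\<close>)
  have b2: "norm (\<Sum>n. f n k) \<le> suminf u * v k" for k
    by (subst suminf_mult2[OF u(1)], rule norm_suminf_le)
      (use bound u in \<open>auto intro: summable_mult2\<close>)
  have n1: "summable (\<lambda>n. norm (\<Sum>k. f n k))"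
    by (rule summable_comparison_test'[where g="\<lambda>n. u n * suminf v"])
      (use b1 u in \<open>auto intro: summable_mult2\<close>)
  have n2: "summable (\<lambda>k. norm (\<Sum>n. f n k))"
    by (rule summable_comparison_test'[where g="\<lambda>k. suminf u * v k"])
      (use b2 v in \<open>auto intro: summable_mult\<close>)
  have "(\<lambda>p. u (fst p) * v (snd p)) summable_on UNIV \<times> UNIV"
  proof (rule summable_on_SigmaI)
    show "((\<lambda>k. u (fst (n, k)) * v (snd (n, k))) has_sum u n * suminf v) UNIV" for n
      using v by (auto intro!: has_sum_cmult_right sums_nonneg_imp_has_sum summable_sums)
    show "(\<lambda>n. u n * suminf v) summable_on UNIV"
      using u by (intro summable_on_cmult_left) (simp add: summable_on_UNIV_nonneg_real_iff)
  qed (use u v in auto)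
  then have "(\<lambda>p. norm (f (fst p) (snd p))) summable_on UNIV \<times> UNIV"
    by (rule Infinite_Sum.abs_summable_on_comparison_test') (use bound in auto)
  then have "(\<lambda>(n, k). f n k) summable_on UNIV \<times> UNIV"
    unfolding case_prod_unfold by (rule abs_summable_summable)
  then have "infsum (\<lambda>n. infsum (f n) UNIV) UNIV = infsum (\<lambda>k. infsum (\<lambda>n. f n k) UNIV) UNIV"
    by (rule infsum_swap_banach)
  moreover have "infsum (\<lambda>n. \<Sum>k. f n k) UNIV = (\<Sum>n. \<Sum>k. f n k)"
    by (rule infsumI, rule norm_summable_imp_has_sum[OF n1])
      (use n1 in \<open>auto intro: summable_norm_cancel\<close>)
  moreover have "infsum (\<lambda>k. \<Sum>n. f n k) UNIV = (\<Sum>k. \<Sum>n. f n k)"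
    by (rule infsumI, rule norm_summable_imp_has_sum[OF n2])
      (use n2 in \<open>auto intro: summable_norm_cancel\<close>)
  ultimately show ?thesis
    by (simp add: inf1 inf2)
qed

section \<open>Splitting, bounds and positivity of q-Pochhammer symbols\<close>

lemma q_pochhammer_0 [simp]: "q_pochhammer a q 0 = 1"
  by (simp add: q_pochhammer_def)

lemma q_pochhammer_Suc: "q_pochhammer a q (Suc n) = q_pochhammer a q n * (1 - a * of_real q ^ n)"
  by (simp add: q_pochhammer_def)

lemma q_pochhammer_add:
  "q_pochhammer a q (m + n) = q_pochhammer a q m * q_pochhammer (a * of_real q ^ m) q n"
  by (induction n) (simp_all add: q_pochhammer_Suc power_add mult_ac)

lemma q_pochhammer_one_Suc [simp]: "q_pochhammer 1 q (Suc n) = 0"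
  by (induction n) (simp_all add: q_pochhammer_Suc)

lemma q_pochhammer_tendsto:
  fixes a :: "'a::{real_normed_field,banach}"
  assumes "0 < q" "q < 1"
  shows "q_pochhammer a q \<longlonglongrightarrow> q_pochhammer_inf a q"
  using has_prod_imp_tendsto'[OF q_pochhammer_inf_has_prod[OF assms]]
  by (simp add: q_pochhammer_def[abs_def])

text \<open>The limit of \<open>q_pochhammer_add\<close> as the second index grows. With
  \<open>a = q\<close> it turns (q^(n+1);q)_inf into (q;q)_inf / (q;q)_n.\<close>

lemma q_pochhammer_inf_split:
  fixes a :: "'a::{real_normed_field,banach}"
  assumes "0 < q" "q < 1"
  shows "q_pochhammer_inf a q = q_pochhammer a q n * q_pochhammer_inf (a * of_real q ^ n) q"
proof (rule LIMSEQ_unique)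
  show "(\<lambda>k. q_pochhammer a q (n + k)) \<longlonglongrightarrow> q_pochhammer_inf a q"
    using LIMSEQ_ignore_initial_segment[OF q_pochhammer_tendsto[OF assms], of a n]
    by (simp add: add.commute)
  show "(\<lambda>k. q_pochhammer a q (n + k)) \<longlonglongrightarrow>
      q_pochhammer a q n * q_pochhammer_inf (a * of_real q ^ n) q"
    unfolding q_pochhammer_add by (intro tendsto_intros q_pochhammer_tendsto assms)
qed

text \<open>Each factor is at most 1 + r q^j in norm, and products of such factors, all at least 1,
  increase to their limit. Uniformity in \<open>n\<close> is what produces the growth rate of the
  theorem.\<close>

lemma norm_q_pochhammer_le:
  fixes z :: "'a::{real_normed_field,banach}"
  assumes "0 < q" "q < 1" "norm z \<le> r"
  shows "norm (q_pochhammer z q n) \<le> q_pochhammer_inf (- r) q"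
proof -
  have r: "0 \<le> r"
    using assms(3) norm_ge_zero order_trans by blast
  have "norm (1 - z * of_real q ^ j) \<le> 1 - (- r) * q ^ j" for j
  proof -
    have "norm (1 - z * of_real q ^ j) \<le> 1 + norm z * q ^ j"
      using norm_triangle_ineq4[of 1 "z * of_real q ^ j"] assms
      by (simp add: norm_mult norm_power)
    also have "\<dots> \<le> 1 - (- r) * q ^ j"
      using assms by (simp add: mult_right_mono)
    finally show ?thesis .
  qed
  then have "norm (q_pochhammer z q n) \<le> q_pochhammer (- r) q n"
    unfolding q_pochhammer_def by (auto simp: prod_norm[symmetric] intro!: prod_mono)
  also have "\<dots> \<le> q_pochhammer_inf (- r) q"
  proof (rule incseq_le[OF incseq_SucI q_pochhammer_tendsto[OF assms(1,2)]])
    fix n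
    have "q_pochhammer (- r) q n * 1 \<le> q_pochhammer (- r) q n * (1 + r * q ^ n)"
    proof (rule mult_left_mono)
      show "0 \<le> q_pochhammer (- r) q n"
        unfolding q_pochhammer_def using assms r by (intro prod_nonneg) simp
    qed (use assms r in simp)
    then show "q_pochhammer (- r) q n \<le> q_pochhammer (- r) q (Suc n)"
      by (simp add: q_pochhammer_Suc)
  qed
  finally show ?thesis .
qed

lemma q_pochhammer_inf_pos:
  fixes x :: real
  assumes "0 < q" "q < 1" "x < 1"
  shows "0 < q_pochhammer_inf x q"
proof -
  have pos: "0 < 1 - x * q ^ j" for j
  proof (cases "x \<le> 0")
    case True
    then have "x * q ^ j \<le> 0"
      using assms by (simp add: mult_nonpos_nonneg)
    then show ?thesis by simp
  next
    case False
    then have "x * q ^ j \<le> x * 1"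
      using assms by (intro mult_left_mono power_le_one) auto
    then show ?thesis using assms by simp
  qed
  have prod: "(\<lambda>j. 1 - x * q ^ j) has_prod q_pochhammer_inf x q"
    using q_pochhammer_inf_has_prod[OF assms(1,2), of x] by simp
  have "0 \<notin> range (\<lambda>j. 1 - x * q ^ j)"
    using less_imp_neq[OF pos] by blast
  \<comment> \<open>In the sense of \<open>has_prod\<close>, a convergent product vanishes only if
    one of its factors does.\<close>
  then have "q_pochhammer_inf x q \<noteq> 0"
    using has_prod_eq_0_iff[OF prod] by simp
  moreover have "0 \<le> q_pochhammer_inf x q"
    by (rule has_prod_nonneg[OF prod]) (rule less_imp_le[OF pos])
  ultimately show ?thesis by simp
qed

text \<open>The factors 1 - q^(j+1) lie in [0,1], so the partial products decrease to their limit.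
  This bounds all denominators (q;q)_n below by one positive constant.\<close>

lemma q_pochhammer_q_ge:
  assumes "0 < q" "q < 1"
  shows "q_pochhammer_inf q q \<le> q_pochhammer q q n"
proof (rule decseq_ge[OF decseq_SucI q_pochhammer_tendsto[OF assms]])
  fix n
  have le: "q * q ^ j \<le> 1" for j
    using power_le_one[of q "Suc j"] assms by simp
  have "q_pochhammer q q n * (1 - q * q ^ n) \<le> q_pochhammer q q n"
  proof (rule mult_right_le_one_le)
    show "0 \<le> q_pochhammer q q n"
      unfolding q_pochhammer_def using le by (intro prod_nonneg) simp
  qed (use le assms in simp_all)
  then show "q_pochhammer q q (Suc n) \<le> q_pochhammer q q n"
    by (simp add: q_pochhammer_Suc)
qed

lemma q_pochhammer_q_pos:
  assumes "0 < q" "q < 1"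
  shows "0 < q_pochhammer q q n"
  using q_pochhammer_q_ge[OF assms, of n] q_pochhammer_inf_pos[OF assms assms(2)] by linarith

lemma abs_divide_q_pochhammer_le:
  assumes "0 < q" "q < 1"
  shows "\<bar>x / q_pochhammer q q n\<bar> \<le> \<bar>x\<bar> / q_pochhammer_inf q q"
proof -
  have "\<bar>x / q_pochhammer q q n\<bar> = \<bar>x\<bar> / q_pochhammer q q n"
    using q_pochhammer_q_pos[OF assms, of n] by simp
  also have "\<dots> \<le> \<bar>x\<bar> / q_pochhammer_inf q q"
    using q_pochhammer_q_ge[OF assms, of n] q_pochhammer_inf_pos[OF assms assms(2)]
    by (intro divide_left_mono) auto
  finally show ?thesis .
qed

section \<open>Euler's two identities via q-difference equations\<close>

text \<open>Continuity of the power series at 0. It supplies the limit once a functional equation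
  under x -> xq has been iterated.\<close>

lemma powser_tendsto_qpow:
  fixes a :: "nat \<Rightarrow> real"
  assumes "0 < q" "q < 1" and summable: "\<And>x. \<bar>x\<bar> < 1 \<Longrightarrow> summable (\<lambda>k. a k * x ^ k)"
  shows "(\<lambda>n. \<Sum>k. a k * (x * q ^ n) ^ k) \<longlonglongrightarrow> a 0"
proof -
  have "isCont (\<lambda>x. \<Sum>k. a k * x ^ k) 0"
    by (rule isCont_powser[where K="1/2"]) (simp_all add: summable del: power_divide)
  moreover have "(\<lambda>n. x * q ^ n) \<longlonglongrightarrow> x * 0"
    using assms by (intro tendsto_intros LIMSEQ_power_zero) auto
  ultimately have "(\<lambda>n. \<Sum>k. a k * (x * q ^ n) ^ k) \<longlonglongrightarrow> (\<Sum>k. a k * 0 ^ k)"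
    by (intro isCont_tendsto_compose[where g="\<lambda>x. \<Sum>k. a k * x ^ k"]) auto
  then show ?thesis by simp
qed

text \<open>Replacing x by xq and subtracting multiplies the k-th coefficient by 1 - q^k. The
  constant term disappears, hence the shift to \<open>Suc k\<close>; the new factor will cancel the
  last factor of (q;q)_(k+1).\<close>

lemma powser_diff_q:
  fixes a :: "nat \<Rightarrow> real"
  assumes "summable (\<lambda>k. a k * x ^ k)" "summable (\<lambda>k. a k * (x * q) ^ k)"
  shows "(\<Sum>k. a k * x ^ k) - (\<Sum>k. a k * (x * q) ^ k)
      = (\<Sum>k. a (Suc k) * (1 - q ^ Suc k) * x ^ Suc k)"
proof -
  let ?d = "\<lambda>k. a k * (1 - q ^ k) * x ^ k"
  have d: "?d = (\<lambda>k. a k * x ^ k - a k * (x * q) ^ k)"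
    by (simp add: fun_eq_iff power_mult_distrib algebra_simps)
  have "summable ?d"
    unfolding d by (intro summable_diff assms)
  then have "suminf ?d = (\<Sum>k. ?d (Suc k))"
    using suminf_split_head[of ?d] by simp
  moreover have "suminf ?d = (\<Sum>k. a k * x ^ k) - (\<Sum>k. a k * (x * q) ^ k)"
    unfolding d by (rule suminf_diff[OF assms, symmetric])
  ultimately show ?thesis by simp
qed

lemma abs_mult_qpow_less_1:
  fixes x :: real
  assumes "0 < q" "q < 1" "\<bar>x\<bar> < 1"
  shows "\<bar>x * q ^ n\<bar> < 1"
proof -
  have "\<bar>x * q ^ n\<bar> \<le> \<bar>x\<bar> * 1"
    unfolding abs_mult using assms by (intro mult_left_mono) (auto intro: power_le_one)
  then show ?thesis using assms by simp
qed

text \<open>The series \<open>h\<close> satisfies h(yq) = (1 - y) h(y). Iteration gives h(x q^n) =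
  (x;q)_n h(x), and n -> infinity yields 1 = (x;q)_inf h(x).\<close>

lemma Euler_sums_inverse:
  fixes x :: real
  assumes "0 < q" "q < 1" "\<bar>x\<bar> < 1"
  shows "(\<lambda>k. x ^ k / q_pochhammer q q k) sums (1 / q_pochhammer_inf x q)"
proof -
  define a where "a k = 1 / q_pochhammer q q k" for k
  define h where "h y = (\<Sum>k. a k * y ^ k)" for y
  have summable: "summable (\<lambda>k. a k * y ^ k)" if "\<bar>y\<bar> < 1" for y
  proof (rule summable_comparison_test'[where g="\<lambda>k. \<bar>y\<bar> ^ k / q_pochhammer_inf q q"])
    show "summable (\<lambda>k. \<bar>y\<bar> ^ k / q_pochhammer_inf q q)"
      using that by (intro summable_divide summable_geometric) auto
    show "norm (a k * y ^ k) \<le> \<bar>y\<bar> ^ k / q_pochhammer_inf q q" for k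
      using abs_divide_q_pochhammer_le[OF assms(1,2), of "y ^ k" k] by (simp add: a_def power_abs)
  qed
  have a_Suc: "a (Suc k) * (1 - q ^ Suc k) = a k" for k
    using q_pochhammer_q_pos[OF assms(1,2), of "Suc k"]
    by (auto simp: a_def q_pochhammer_Suc)
  have step: "h (y * q) = (1 - y) * h y" if y: "\<bar>y\<bar> < 1" for y
  proof -
    have "h y - h (y * q) = (\<Sum>k. y * (a k * y ^ k))"
      unfolding h_def
      using powser_diff_q[OF summable[OF y] summable, of q]
        abs_mult_qpow_less_1[OF assms(1,2) y, of 1]
      by (simp only: a_Suc) (simp add: mult_ac)
    also have "\<dots> = y * h y"
      unfolding h_def by (rule suminf_mult[OF summable[OF y]])
    finally show ?thesis by (simp add: algebra_simps)
  qed
  have "h (x * q ^ n) = q_pochhammer x q n * h x" for n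
  proof (induction n)
    case (Suc n)
    then show ?case
      using step[OF abs_mult_qpow_less_1[OF assms, of n]] by (simp add: q_pochhammer_Suc mult_ac)
  qed simp
  then have "(\<lambda>n. q_pochhammer x q n * h x) \<longlonglongrightarrow> a 0"
    using powser_tendsto_qpow[OF assms(1,2) summable, of x] by (simp add: h_def)
  moreover have "(\<lambda>n. q_pochhammer x q n * h x) \<longlonglongrightarrow> q_pochhammer_inf x q * h x"
    by (intro tendsto_intros q_pochhammer_tendsto assms)
  ultimately have "q_pochhammer_inf x q * h x = 1"
    using LIMSEQ_unique a_def by fastforce
  \<comment> \<open>The divisor is nonzero because its product with \<open>h x\<close> is 1.\<close>
  then have "h x = 1 / q_pochhammer_inf x q"
    by (metis mult_zero_left nonzero_eq_divide_eq mult.commute zero_neq_one)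
  then show ?thesis
    using summable_sums[OF summable[OF assms(3)]] by (simp add: h_def a_def)
qed

text \<open>Here the equation is g(y) = (1 - y) g(yq), so iteration gives g(x) = (x;q)_n g(x q^n),
  whose limit is (x;q)_inf times the constant coefficient 1.\<close>

lemma Euler_sums:
  fixes x :: real
  assumes "0 < q" "q < 1" "\<bar>x\<bar> < 1"
  shows "(\<lambda>k. (-1) ^ k * q ^ (k choose 2) / q_pochhammer q q k * x ^ k) sums q_pochhammer_inf x q"
proof -
  define a where "a k = (-1) ^ k * q ^ (k choose 2) / q_pochhammer q q k" for k
  define g where "g y = (\<Sum>k. a k * y ^ k)" for y
  have summable: "summable (\<lambda>k. a k * y ^ k)" if "\<bar>y\<bar> < 1" for y
  proof (rule summable_comparison_test'[where g="\<lambda>k. 1 / q_pochhammer_inf q q * \<bar>y\<bar> ^ k"])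
    show "summable (\<lambda>k. 1 / q_pochhammer_inf q q * \<bar>y\<bar> ^ k)"
      using that by (intro summable_mult summable_geometric) auto
    show "norm (a k * y ^ k) \<le> 1 / q_pochhammer_inf q q * \<bar>y\<bar> ^ k" for k
    proof -
      have "\<bar>a k\<bar> \<le> \<bar>(-1) ^ k * q ^ (k choose 2)\<bar> / q_pochhammer_inf q q"
        unfolding a_def by (rule abs_divide_q_pochhammer_le[OF assms(1,2)])
      also have "\<dots> \<le> 1 / q_pochhammer_inf q q"
        using assms q_pochhammer_inf_pos[OF assms(1,2,2)]
        by (intro divide_right_mono) (auto simp: abs_mult power_abs power_le_one)
      finally show ?thesis
        by (simp only: real_norm_def abs_mult power_abs) (intro mult_right_mono, auto)
    qed
  qed
  \<comment> \<open>The factor q^k comes from \<open>(Suc k choose 2) = (k choose 2) + k\<close>; it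
    is absorbed into \<open>y ^ k\<close> and produces the argument \<open>y * q\<close>.\<close>
  have a_Suc: "a (Suc k) * (1 - q ^ Suc k) = - (a k * q ^ k)" for k
    using q_pochhammer_q_pos[OF assms(1,2), of "Suc k"]
    by (auto simp: a_def q_pochhammer_Suc numeral_2_eq_2 power_add)
  have step: "g y = (1 - y) * g (y * q)" if y: "\<bar>y\<bar> < 1" for y
  proof -
    have yq: "\<bar>y * q\<bar> < 1"
      using abs_mult_qpow_less_1[OF assms(1,2) y, of 1] by simp
    have "g y - g (y * q) = (\<Sum>k. (- y) * (a k * (y * q) ^ k))"
      unfolding g_def
      using powser_diff_q[OF summable[OF y] summable[OF yq]]
      by (simp only: a_Suc) (simp add: mult_ac power_mult_distrib)
    also have "\<dots> = (- y) * g (y * q)"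
      unfolding g_def by (rule suminf_mult[OF summable[OF yq]])
    finally show ?thesis by (simp add: algebra_simps)
  qed
  have "g x = q_pochhammer x q n * g (x * q ^ n)" for n
  proof (induction n)
    case (Suc n)
    then show ?case
      using step[OF abs_mult_qpow_less_1[OF assms, of n]] by (simp add: q_pochhammer_Suc mult_ac)
  qed simp
  moreover have "(\<lambda>n. q_pochhammer x q n * g (x * q ^ n)) \<longlonglongrightarrow> q_pochhammer_inf x q * a 0"
    unfolding g_def
    by (intro tendsto_mult q_pochhammer_tendsto powser_tendsto_qpow summable assms)
  ultimately have "(\<lambda>n. g x) \<longlonglongrightarrow> q_pochhammer_inf x q * a 0"
    by simp
  then have "g x = q_pochhammer_inf x q"
    by (simp add: LIMSEQ_const_iff a_def numeral_2_eq_2)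
  then show ?thesis
    using summable_sums[OF summable[OF assms(3)]] by (simp add: g_def a_def)
qed

section \<open>The coefficients as power series in q^k\<close>

text \<open>The q-integral samples at q^j, where (q^(j+1);q)_inf = (q;q)_inf / (q;q)_j and
  (q^(j+1))^k = q^k (q^k)^j. The normalisation q^(-k) / (1-q) then cancels. The form as a power
  series at q^k prepares for a Cauchy product.\<close>

lemma q_durrmeyer_coeff_eq:
  assumes "0 < q" "q < 1"
    and summable: "summable (\<lambda>j. f (q ^ j) * of_real (q ^ j / q_pochhammer q q j) * of_real (q ^ k) ^ j)"
  shows "q_durrmeyer_coeff q f k = of_real (q_pochhammer_inf q q / q_pochhammer q q k) *
    (\<Sum>j. f (q ^ j) * of_real (q ^ j / q_pochhammer q q j) * of_real (q ^ k) ^ j)"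
    (is "_ = of_real ?L * suminf ?s")
proof -
  have "q ^ j *\<^sub>R (f (1 * q ^ j) * of_real (limit_q_basis q k (q * (1 * q ^ j))))
      = of_real (q ^ k * ?L) * ?s j" for j
  proof -
    have "q_pochhammer_inf (q * q ^ j) q = q_pochhammer_inf q q / q_pochhammer q q j"
      using q_pochhammer_inf_split[OF assms(1,2), of q j] q_pochhammer_q_pos[OF assms(1,2), of j]
      by (simp add: field_simps)
    then have "limit_q_basis q k (q * (1 * q ^ j)) =
        q ^ k * ?L * (1 / q_pochhammer q q j) * (q ^ k) ^ j"
      by (simp add: limit_q_basis_def power_mult_distrib power_mult[symmetric] mult_ac)
    then show ?thesis
      by (simp add: scaleR_conv_of_real mult_ac)
  qed
  then have "q_integral q 1 (\<lambda>t. f t * of_real (limit_q_basis q k (q * t)))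
      = (1 - q) *\<^sub>R (\<Sum>j. of_real (q ^ k * ?L) * ?s j)"
    unfolding q_integral_def by simp
  also have "(\<Sum>j. of_real (q ^ k * ?L) * ?s j) = of_real (q ^ k * ?L) * suminf ?s"
    by (rule suminf_mult[OF summable])
  finally have "q_durrmeyer_coeff q f k =
      of_real (q powi (- int k) / (1 - q) * (1 - q) * (q ^ k * ?L)) * suminf ?s"
    by (simp add: q_durrmeyer_coeff_def scaleR_conv_of_real mult_ac)
  also have "q powi (- int k) / (1 - q) * (1 - q) * (q ^ k * ?L) = ?L"
    using assms(1,2) by (simp add: power_int_minus)
  finally show ?thesis .
qed

section \<open>Series in the polynomials (z;q)_n\<close>

lemma q_pochhammer_series_holomorphic:
  fixes c :: "nat \<Rightarrow> complex"
  assumes "0 < q" "q < 1" and c: "summable (\<lambda>n. norm (c n))"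
  shows "(\<lambda>z. \<Sum>n. c n * q_pochhammer z q n) holomorphic_on UNIV"
proof (rule holomorphic_uniform_sequence[OF open_UNIV])
  show "(\<lambda>z. \<Sum>n<N. c n * q_pochhammer z q n) holomorphic_on UNIV" for N
    unfolding q_pochhammer_def by (intro holomorphic_intros)
  fix w :: complex
  \<comment> \<open>The unit disc about \<open>w\<close> lies in the disc of radius
    \<open>norm w + 1\<close> about 0, which gives a majorant for the Weierstrass test independent
    of \<open>z\<close>.\<close>
  have "norm (c n * q_pochhammer z q n) \<le> norm (c n) * q_pochhammer_inf (- (norm w + 1)) q"
    if "z \<in> cball w 1" for n z
  proof -
    have "norm z \<le> norm w + 1"
      using that norm_triangle_ineq2[of z w] by (simp add: dist_norm norm_minus_commute)
    from norm_q_pochhammer_le[OF assms(1,2) this] show ?thesis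
      unfolding norm_mult by (rule mult_left_mono) simp
  qed
  then have "uniform_limit (cball w 1) (\<lambda>N z. \<Sum>n<N. c n * q_pochhammer z q n)
      (\<lambda>z. \<Sum>n. c n * q_pochhammer z q n) sequentially"
    by (rule Weierstrass_m_test[OF _ summable_mult2[OF c]])
  then show "\<exists>d>0. cball w d \<subseteq> UNIV \<and> uniform_limit (cball w d)
      (\<lambda>N z. \<Sum>n<N. c n * q_pochhammer z q n) (\<lambda>z. \<Sum>n. c n * q_pochhammer z q n) sequentially"
    by (intro exI[of _ 1]) auto
qed

lemma norm_q_pochhammer_series_le:
  fixes c :: "nat \<Rightarrow> complex"
  assumes "0 < q" "q < 1" and c: "summable (\<lambda>n. norm (c n))" and "norm z \<le> r"
  shows "norm (\<Sum>n. c n * q_pochhammer z q n) \<le> (\<Sum>n. norm (c n)) * q_pochhammer_inf (- r) q"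
proof (subst suminf_mult2[OF c], rule norm_suminf_le)
  show "norm (c n * q_pochhammer z q n) \<le> norm (c n) * q_pochhammer_inf (- r) q" for n
    using norm_q_pochhammer_le[OF assms(1,2,4)] by (auto simp: norm_mult intro!: mult_left_mono)
qed (intro summable_mult2 c)

lemma q_pochhammer_series_eq:
  fixes c :: "nat \<Rightarrow> complex" and x :: real
  assumes "0 < q" "q < 1" "0 \<le> x" "x < 1" and c: "summable (\<lambda>n. norm (c n))"
  shows "(\<Sum>n. c n * q_pochhammer (of_real x) q n) =
    (\<Sum>k. (\<Sum>n. c n * of_real (q ^ k) ^ n) * of_real (limit_q_basis q k x))"
proof -
  let ?P = "q_pochhammer_inf x q" and ?L = "q_pochhammer_inf q q"
  have pos: "0 < ?P" "0 < ?L"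
    using q_pochhammer_inf_pos assms by auto
  define t where "t n k = c n * of_real (q ^ k) ^ n * of_real (limit_q_basis q k x)" for n k
  have basis: "\<bar>limit_q_basis q k x\<bar> \<le> ?P / ?L * x ^ k" for k
    using abs_divide_q_pochhammer_le[OF assms(1,2), of "?P * x ^ k" k] pos assms
    by (simp add: limit_q_basis_def)
  have qpow: "norm (complex_of_real (q ^ k) ^ n) \<le> 1" for k n
    using assms by (auto simp: norm_power intro!: power_le_one)
  \<comment> \<open>Since the powers of q^k are at most 1, the double series is dominated by the
    product of \<open>norm (c n)\<close> and a geometric sequence, which converges because x <
    1.\<close>
  have "norm (t n k) \<le> norm (c n) * (?P / ?L * x ^ k)" for n k
  proof -
    have "norm (t n k) \<le> norm (c n) * 1 * (?P / ?L * x ^ k)"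
      unfolding t_def norm_mult norm_of_real
      by (intro mult_mono basis qpow mult_nonneg_nonneg order_refl) auto
    then show ?thesis by simp
  qed
  then have "(\<Sum>n. \<Sum>k. t n k) = (\<Sum>k. \<Sum>n. t n k)"
    by (rule suminf_swap_dominated)
      (use c pos assms in \<open>auto intro!: summable_mult summable_geometric\<close>)
  moreover have "(\<Sum>k. t n k) = c n * q_pochhammer (of_real x) q n" for n
  proof -
    have "\<bar>x * q ^ n\<bar> < 1"
      using abs_mult_qpow_less_1[OF assms(1,2), of x n] assms by simp
    moreover have "?P = q_pochhammer x q n * q_pochhammer_inf (x * q ^ n) q"
      using q_pochhammer_inf_split[OF assms(1,2), of x n] by simp
    \<comment> \<open>Euler's first identity at \<open>x * q ^ n\<close>: the quotient of (x;q)_inf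
      by (x q^n;q)_inf is the finite symbol.\<close>
    ultimately have "(\<lambda>k. ?P * ((x * q ^ n) ^ k / q_pochhammer q q k)) sums q_pochhammer x q n"
      using sums_mult[OF Euler_sums_inverse[OF assms(1,2)], of "x * q ^ n" ?P] pos
      by (auto simp: field_simps split: if_splits)
    then have "(\<lambda>k. (q ^ k) ^ n * limit_q_basis q k x) sums q_pochhammer x q n"
      by (simp add: limit_q_basis_def power_mult_distrib power_mult[symmetric] mult_ac)
    then have "(\<lambda>k. c n * of_real ((q ^ k) ^ n * limit_q_basis q k x))
        sums (c n * of_real (q_pochhammer x q n))"
      by (intro sums_mult sums_of_real)
    moreover have "of_real (q_pochhammer x q n) = q_pochhammer (complex_of_real x) q n"
      by (simp add: q_pochhammer_def)
    ultimately show ?thesis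
      unfolding t_def by (simp add: sums_iff mult_ac)
  qed
  moreover have "(\<Sum>n. t n k) = (\<Sum>n. c n * of_real (q ^ k) ^ n) * of_real (limit_q_basis q k x)" for k
  proof -
    have "norm (c n * of_real (q ^ k) ^ n) \<le> norm (c n)" for n
      using mult_left_mono[OF qpow[of k n], of "norm (c n)"] by (simp add: norm_mult)
    then have "summable (\<lambda>n. c n * of_real (q ^ k) ^ n)"
      by (rule summable_comparison_test'[OF c])
    then show ?thesis
      unfolding t_def by (rule suminf_mult2[symmetric])
  qed
  ultimately show ?thesis by simp
qed

section \<open>The expansion of the entire extension and the growth bound\<close>

lemma q_durrmeyer_entire_expansion:
  assumes q: "0 < q" "q < 1" and "continuous_on {0..1} f"
  obtains c where "summable (\<lambda>n. norm (c n))"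
    and "q_durrmeyer_entire q f = (\<lambda>z. \<Sum>n. c n * q_pochhammer z q n)"
proof -
  let ?L = "q_pochhammer_inf q q"
  have L: "0 < ?L"
    using q_pochhammer_inf_pos q by auto
  have "bounded (f ` {0..1})"
    using assms(3) by (intro compact_imp_bounded compact_continuous_image) auto
  then obtain B where "\<forall>x\<in>{0..1}. norm (f x) \<le> B"
    unfolding bounded_iff by auto
  then have B: "norm (f x) \<le> B" if "x \<in> {0..1}" for x
    using that by blast
  define a where "a j = f (q ^ j) * of_real (q ^ j / q_pochhammer q q j)" for j
  \<comment> \<open>These are the coefficients of (qy;q)_inf in powers of y. At y = q^k the series
    sums to (q;q)_inf / (q;q)_k, the prefactor in \<open>q_durrmeyer_coeff_eq\<close>. The factor
    \<open>q ^ m\<close> also ensures absolute summability at y = 1.\<close>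
  define b where "b m = complex_of_real
    ((-1) ^ m * q ^ (m choose 2) / q_pochhammer q q m * q ^ m)" for m
  define c where "c n = (\<Sum>i\<le>n. a i * b (n - i))" for n
  have qpow: "norm (complex_of_real (q ^ k) ^ n) \<le> 1" for k n
    using q by (auto simp: norm_power intro!: power_le_one)
  have a: "summable (\<lambda>j. norm (a j))"
  proof (rule summable_comparison_test')
    show "summable (\<lambda>j. B / ?L * q ^ j)"
      using q by (intro summable_mult summable_geometric) auto
    show "norm (norm (a j)) \<le> B / ?L * q ^ j" for j
    proof -
      \<comment> \<open>The instance \<open>B[of 0]\<close> supplies
        \<open>0 \<le> B\<close>.\<close>
      have "norm (a j) \<le> B * (\<bar>q ^ j\<bar> / ?L)"
        unfolding a_def norm_mult norm_of_real using q B[of 0]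
        by (intro mult_mono B abs_divide_q_pochhammer_le)
          (auto intro: power_le_one order_trans[OF norm_ge_zero])
      then show ?thesis using q by simp
    qed
  qed
  have b: "summable (\<lambda>m. norm (b m))"
  proof (rule summable_comparison_test')
    show "summable (\<lambda>m. 1 / ?L * q ^ m)"
      using q by (intro summable_mult summable_geometric) auto
    show "norm (norm (b m)) \<le> 1 / ?L * q ^ m" for m
    proof -
      have "norm (b m) \<le> \<bar>(-1) ^ m * q ^ (m choose 2)\<bar> / ?L * \<bar>q ^ m\<bar>"
        unfolding b_def norm_of_real abs_mult[of _ "q ^ m"]
        by (intro mult_right_mono abs_divide_q_pochhammer_le q) simp
      also have "\<dots> \<le> 1 / ?L * q ^ m"
        using q L by (auto simp: abs_mult power_abs intro!: mult_right_mono divide_right_mono power_le_one)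
      finally show ?thesis by simp
    qed
  qed
  have c: "summable (\<lambda>n. norm (c n))"
  proof (rule summable_comparison_test')
    show "summable (\<lambda>n. \<Sum>i\<le>n. norm (a i) * norm (b (n - i)))"
      using summable_Cauchy_product[of "\<lambda>j. norm (a j)" "\<lambda>m. norm (b m)"] a b by simp
    show "norm (norm (c n)) \<le> (\<Sum>i\<le>n. norm (a i) * norm (b (n - i)))" for n
      unfolding c_def by (auto simp: norm_mult[symmetric] intro: norm_sum)
  qed
  have twist: "summable (\<lambda>n. norm (d n * of_real (q ^ k) ^ n))"
    if "summable (\<lambda>n. norm (d n))" for d :: "nat \<Rightarrow> complex" and k
    by (rule summable_comparison_test'[OF that])
      (use mult_left_mono[OF qpow, of "norm (d _)"] in \<open>simp add: norm_mult\<close>)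
  have coeff: "(\<Sum>n. c n * of_real (q ^ k) ^ n) = q_durrmeyer_coeff q f k" for k
  proof -
    \<comment> \<open>The extra factor \<open>q\<close> keeps the argument inside the unit disc even
      for k = 0.\<close>
    have "\<bar>q * q ^ k\<bar> < 1"
      using abs_mult_qpow_less_1[OF q, of q k] q by simp
    from sums_of_real[OF Euler_sums[OF q this], where ?'a = complex]
    have "(\<Sum>m. b m * of_real (q ^ k) ^ m) = of_real (q_pochhammer_inf (q * q ^ k) q)"
      by (simp add: sums_iff b_def power_mult_distrib mult_ac)
    also have "q_pochhammer_inf (q * q ^ k) q = ?L / q_pochhammer q q k"
      using q_pochhammer_inf_split[OF q, of q k] q_pochhammer_q_pos[OF q, of k]
      by (simp add: field_simps)
    finally have B: "(\<Sum>m. b m * of_real (q ^ k) ^ m) = of_real (?L / q_pochhammer q q k)" .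
    have "(\<Sum>j. a j * of_real (q ^ k) ^ j) * (\<Sum>m. b m * of_real (q ^ k) ^ m) =
        (\<Sum>n. \<Sum>i\<le>n. a i * of_real (q ^ k) ^ i * (b (n - i) * of_real (q ^ k) ^ (n - i)))"
      by (rule Cauchy_product[OF twist[OF a] twist[OF b]])
    also have "\<dots> = (\<Sum>n. c n * of_real (q ^ k) ^ n)"
    proof (intro suminf_cong)
      fix n
      show "(\<Sum>i\<le>n. a i * of_real (q ^ k) ^ i * (b (n - i) * of_real (q ^ k) ^ (n - i)))
          = c n * of_real (q ^ k) ^ n"
        unfolding c_def sum_distrib_right
      proof (intro sum.cong refl)
        fix i assume "i \<in> {..n}"
        then have "complex_of_real (q ^ k) ^ n = of_real (q ^ k) ^ i * of_real (q ^ k) ^ (n - i)"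
          by (simp add: power_add[symmetric] del: of_real_power)
        then show "a i * of_real (q ^ k) ^ i * (b (n - i) * of_real (q ^ k) ^ (n - i))
            = a i * b (n - i) * of_real (q ^ k) ^ n"
          by (simp only: mult_ac)
      qed
    qed
    finally show ?thesis
      using q_durrmeyer_coeff_eq[OF q, of f k] summable_norm_cancel[OF twist[OF a, of k]]
      unfolding a_def B by (simp only: mult.commute)
  qed
  define F where "F z = (\<Sum>n. c n * q_pochhammer z q n)" for z
  have "is_entire_extension (q_durrmeyer q f) F"
    unfolding is_entire_extension_def
  proof (intro conjI ballI)
    show "F holomorphic_on UNIV"
      unfolding F_def using q_pochhammer_series_holomorphic[OF q c] .
    fix x :: real assume x: "x \<in> {0..1}"
    show "F (of_real x) = q_durrmeyer q f x"
    proof (cases "x = 1")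
      case True
      \<comment> \<open>The value at 1 is prescribed separately, so it is checked directly: (1;q)_n
        vanishes for n > 0, and \<open>c 0 = a 0 * b 0\<close> is \<open>f 1\<close>.\<close>
      have "F 1 = (\<Sum>n\<in>{0}. c n * q_pochhammer 1 q n)"
        unfolding F_def
      proof (rule suminf_finite)
        show "c n * q_pochhammer 1 q n = 0" if "n \<notin> {0}" for n
          using that by (cases n) auto
      qed simp
      also have "\<dots> = f 1"
        by (simp add: c_def a_def b_def numeral_2_eq_2)
      finally show ?thesis
        using True by (simp add: q_durrmeyer_def)
    next
      case False
      then show ?thesis
        using q_pochhammer_series_eq[OF q _ _ c, of x] x
        by (simp add: F_def q_durrmeyer_def coeff del: of_real_power)
    qed
  qed
  then have "q_durrmeyer_entire q f = F"
    unfolding q_durrmeyer_entire_def by (blast intro: the_equality is_entire_extension_unique)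
  with c that show thesis
    unfolding F_def by blast
qed

theorem corollary2p2:
  fixes q :: real and f :: "real \<Rightarrow> complex"
  assumes "0 < q" "q < 1"
    and "continuous_on {0..1} f"
  shows "(\<lambda>r. max_modulus r (q_durrmeyer_entire q f)) \<in> O[at_top](\<lambda>r. q_pochhammer_inf (- r) q)"
proof -
  obtain c where c: "summable (\<lambda>n. norm (c n))"
    and F: "q_durrmeyer_entire q f = (\<lambda>z. \<Sum>n. c n * q_pochhammer z q n)"
    using q_durrmeyer_entire_expansion[OF assms] .
  have "norm (max_modulus r (q_durrmeyer_entire q f))
      \<le> (\<Sum>n. norm (c n)) * norm (q_pochhammer_inf (- r) q)" if r: "0 \<le> r" for r
  proof -
    \<comment> \<open>Continuity makes the supremum a value at some \<open>z\<close> of the disc,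
      where the series bound applies with constant \<open>\<Sum>n. norm (c n)\<close>.\<close>
    have "continuous_on (cball 0 r) (q_durrmeyer_entire q f)"
      using q_pochhammer_series_holomorphic[OF assms(1,2) c] holomorphic_on_imp_continuous_on
        continuous_on_subset unfolding F by blast
    then obtain z where z: "z \<in> cball 0 r"
      "norm (q_durrmeyer_entire q f z) = max_modulus r (q_durrmeyer_entire q f)"
      using max_modulus_attained[OF r] by blast
    have "norm (q_durrmeyer_entire q f z) \<le> (\<Sum>n. norm (c n)) * q_pochhammer_inf (- r) q"
      unfolding F using z(1) by (intro norm_q_pochhammer_series_le[OF assms(1,2) c]) simp
    moreover have "0 < q_pochhammer_inf (- r) q"
      using r by (intro q_pochhammer_inf_pos assms) simp
    ultimately show ?thesis
      using z(2) by (metis abs_norm_cancel abs_of_pos real_norm_def)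
  qed
  then show ?thesis
    by (intro bigoI[where c="\<Sum>n. norm (c n)"] eventually_mono[OF eventually_ge_at_top[of 0]])
qed

end
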